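(* Consider the guaranteed delivery model with bipartite demand-supply graph $G=(A,U,E)$, $A=\{a_1,\dots,a_m\}$, $U=\{u_1,\dots,u_n\}$, required exposures $W_1,\dots,W_m$ (positive integers), $M=\sum_{i=1}^m W_i$, and user type distribution $\mathcal{D}=\{p_j\}_{j=1}^n$. Then for any such input instance, $E(OPT)\geq Z_{flow}$.
   Context: $(a_i,u_j)\in E$ means user type $u_j$ is targeted by campaign $a_i$. Users arrive one at a time with i.i.d. types, $\Pr(\text{type }u_j)=p_j$. Each user may be shown at most one ad, from a campaign targeting her type; all contracts are fulfilled when each $a_i$ has been shown $W_i$ times. $OPT$ is the random variable equal to the smallest $t$ such that the first $t$ users can be assigned (each to at most one campaign targeting her type) so that every $a_i$ receives $W_i$ users (the optimal offline consumption, where previous decisions may be modified). For $T\geq 0$ the expected network $F_G(T)$ is obtained from $G$ by adding a source $s$ and sink $t$, edges $(s,a_i)$ of capacity $W_i$, edges $(u_j,t)$ of capacity $Tp_j$, and giving each edge of $E$ (directed from $A$ to $U$) capacity $M$. $Z_{flow}$ is the minimum $T\ge 0$ such that the maximum $s$-$t$ flow value of $F_G(T)$ equals $M$. *)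

theory Defs
  imports "HOL-Probability.Probability"
begin

subsection \<open>Flows in capacitated networks\<close>

text \<open>A network on the vertex set \<open>V\<close> is given by its capacity function; non-edges have capacity 0.\<close>

definition is_flow ::
    "'v set \<Rightarrow> ('v \<Rightarrow> 'v \<Rightarrow> real) \<Rightarrow> 'v \<Rightarrow> 'v \<Rightarrow> ('v \<Rightarrow> 'v \<Rightarrow> real) \<Rightarrow> bool" where
  "is_flow V c s t f \<longleftrightarrow>
     (\<forall>x\<in>V. \<forall>y\<in>V. 0 \<le> f x y \<and> f x y \<le> c x y) \<and>
     (\<forall>x\<in>V - {s, t}. (\<Sum>y\<in>V. f y x) = (\<Sum>y\<in>V. f x y))"

definition flow_value :: "'v set \<Rightarrow> 'v \<Rightarrow> ('v \<Rightarrow> 'v \<Rightarrow> real) \<Rightarrow> real" where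
  "flow_value V s f = (\<Sum>y\<in>V. f s y) - (\<Sum>y\<in>V. f y s)"

definition is_max_flow_value ::
    "'v set \<Rightarrow> ('v \<Rightarrow> 'v \<Rightarrow> real) \<Rightarrow> 'v \<Rightarrow> 'v \<Rightarrow> real \<Rightarrow> bool" where
  "is_max_flow_value V c s t v \<longleftrightarrow>
     (\<exists>f. is_flow V c s t f \<and> flow_value V s f = v) \<and>
     (\<forall>f. is_flow V c s t f \<longrightarrow> flow_value V s f \<le> v)"

subsection \<open>The expected network\<close>

datatype ('a, 'u) node = Source | Campaign 'a | User 'u | Sink

definition total_demand :: "'a set \<Rightarrow> ('a \<Rightarrow> nat) \<Rightarrow> nat" where
  "total_demand A W = (\<Sum>a\<in>A. W a)"

definition net_nodes :: "'a set \<Rightarrow> 'u set \<Rightarrow> ('a, 'u) node set" where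
  "net_nodes A U = {Source, Sink} \<union> Campaign ` A \<union> User ` U"

fun net_cap ::
    "'a set \<Rightarrow> ('a \<times> 'u) set \<Rightarrow> ('a \<Rightarrow> nat) \<Rightarrow> 'u pmf \<Rightarrow> real \<Rightarrow>
     ('a, 'u) node \<Rightarrow> ('a, 'u) node \<Rightarrow> real" where
  "net_cap A E W p T Source (Campaign a) = real (W a)"
| "net_cap A E W p T (Campaign a) (User u) = (if (a, u) \<in> E then real (total_demand A W) else 0)"
| "net_cap A E W p T (User u) Sink = T * pmf p u"
| "net_cap A E W p T _ _ = 0"

definition saturating_times ::
    "'a set \<Rightarrow> 'u set \<Rightarrow> ('a \<times> 'u) set \<Rightarrow> ('a \<Rightarrow> nat) \<Rightarrow> 'u pmf \<Rightarrow> real set" where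
  "saturating_times A U E W p =
     {T. 0 \<le> T \<and> is_max_flow_value (net_nodes A U) (net_cap A E W p T) Source Sink
                   (real (total_demand A W))}"

text \<open>The infimum is a minimum whenever the set is nonempty, see \<open>Z_flow_is_minimum\<close> below.
  It is \<open>\<infinity>\<close> if no \<open>T\<close> saturates all demands, i.e. if the contracts cannot be fulfilled.\<close>

definition Z_flow ::
    "'a set \<Rightarrow> 'u set \<Rightarrow> ('a \<times> 'u) set \<Rightarrow> ('a \<Rightarrow> nat) \<Rightarrow> 'u pmf \<Rightarrow> ennreal" where
  "Z_flow A U E W p = (INF T\<in>saturating_times A U E W p. ennreal T)"

subsection \<open>Optimal offline consumption\<close>

text \<open>\<open>x i\<close> is the type of the user arriving at position \<open>i\<close> (counted from 0), and \<open>\<sigma> i\<close> the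
  campaign whose ad she is shown, if any.\<close>

definition fulfills ::
    "'a set \<Rightarrow> ('a \<times> 'u) set \<Rightarrow> ('a \<Rightarrow> nat) \<Rightarrow> (nat \<Rightarrow> 'u) \<Rightarrow> nat \<Rightarrow> (nat \<Rightarrow> 'a option) \<Rightarrow> bool" where
  "fulfills A E W x t \<sigma> \<longleftrightarrow>
     (\<forall>i<t. \<forall>a. \<sigma> i = Some a \<longrightarrow> (a, x i) \<in> E) \<and>
     (\<forall>a\<in>A. card {i. i < t \<and> \<sigma> i = Some a} = W a)"

text \<open>\<open>\<infinity>\<close> if no finite initial segment of the users suffices.\<close>

definition OPT :: "'a set \<Rightarrow> ('a \<times> 'u) set \<Rightarrow> ('a \<Rightarrow> nat) \<Rightarrow> (nat \<Rightarrow> 'u) \<Rightarrow> enat" where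
  "OPT A E W x = (INF t\<in>{t. \<exists>\<sigma>. fulfills A E W x t \<sigma>}. enat t)"

subsection \<open>Attainment of the minimum\<close>

lemma finite_net_nodes: "finite A \<Longrightarrow> finite U \<Longrightarrow> finite (net_nodes A U)"
  by (simp add: net_nodes_def)

lemma flow_value_le_total_demand:
  assumes "finite A" "finite U"
    and f: "is_flow (net_nodes A U) (net_cap A E W p T) Source Sink f"
  shows "flow_value (net_nodes A U) Source f \<le> real (total_demand A W)"
proof -
  let ?V = "net_nodes A U"
  have fin: "finite ?V" using assms by (simp add: finite_net_nodes)
  have S: "Source \<in> ?V" by (simp add: net_nodes_def)
  have "(\<Sum>y\<in>?V. f Source y) \<le> (\<Sum>y\<in>?V. net_cap A E W p T Source y)"
    using f S by (intro sum_mono) (auto simp: is_flow_def)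
  also have "\<dots> = (\<Sum>y\<in>Campaign ` A. net_cap A E W p T Source y)"
    using fin by (intro sum.mono_neutral_right) (auto simp: net_nodes_def)
  also have "\<dots> = real (total_demand A W)"
    by (subst sum.reindex) (auto simp: inj_on_def total_demand_def)
  finally have "(\<Sum>y\<in>?V. f Source y) \<le> real (total_demand A W)" .
  moreover have "(\<Sum>y\<in>?V. f y Source) \<ge> 0"
    using f S by (intro sum_nonneg) (auto simp: is_flow_def)
  ultimately show ?thesis by (simp add: flow_value_def)
qed

lemma Z_flow_is_minimum:
  assumes A: "finite A" and U: "finite U" and ne: "saturating_times A U E W p \<noteq> {}"
  obtains T where "T \<in> saturating_times A U E W p"
    and "\<And>T'. T' \<in> saturating_times A U E W p \<Longrightarrow> T \<le> T'"
    and "Z_flow A U E W p = ennreal T"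
proof -
  let ?S = "saturating_times A U E W p" and ?V = "net_nodes A U"
  let ?M = "real (total_demand A W)"
  have S_iff: "T \<in> ?S \<longleftrightarrow> 0 \<le> T \<and>
      (\<exists>f. is_flow ?V (net_cap A E W p T) Source Sink f \<and> flow_value ?V Source f = ?M)" for T
    using flow_value_le_total_demand[OF A U] by (auto simp: saturating_times_def is_max_flow_value_def)
  obtain T1 where T1: "T1 \<in> ?S" using ne by blast
  define B where "B = ?M + T1"
  have B: "?M \<le> B" "T1 \<le> B" "0 \<le> B" using T1 by (auto simp: B_def S_iff)
  have cap_le: "net_cap A E W p T x y \<le> B" if "x \<in> ?V" "y \<in> ?V" "0 \<le> T" "T \<le> T1" for T x y
  proof -
    have "real (W a) \<le> B" if "a \<in> A" for a
      using A that member_le_sum[of a A W] B(1) by (simp add: total_demand_def order_trans[OF _ B(1)] del: of_nat_sum)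
    moreover have "T * pmf p u \<le> T1" for u
      using that mult_left_le[of "pmf p u" T] by (simp add: pmf_le_1 order_trans)
    ultimately show ?thesis using that B
      by (cases "(A, E, W, p, T, x, y)" rule: net_cap.cases)
         (auto simp: net_nodes_def intro: order_trans)
  qed
  define K :: "(real \<times> (('a, 'b) node \<Rightarrow> ('a, 'b) node \<Rightarrow> real)) set" where
    "K = {0..T1} \<times> PiE UNIV (\<lambda>_. PiE UNIV (\<lambda>_. {0..B}))"
  have c1: "compact (PiE UNIV (\<lambda>_. {0..B}) :: (('a, 'b) node \<Rightarrow> real) set)"
    using compactin_PiE[of "\<lambda>_. euclidean" "UNIV :: ('a, 'b) node set" "\<lambda>_. {0..B}"]
    by (simp add: euclidean_product_topology)
  have "compact (PiE UNIV (\<lambda>_. PiE UNIV (\<lambda>_. {0..B})) ::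
      (('a, 'b) node \<Rightarrow> ('a, 'b) node \<Rightarrow> real) set)"
    using compactin_PiE[of "\<lambda>_. euclidean" "UNIV :: ('a, 'b) node set"
        "\<lambda>_. PiE UNIV (\<lambda>_. {0..B}) :: (('a, 'b) node \<Rightarrow> real) set"] c1
    by (simp add: euclidean_product_topology)
  then have K: "compact K" unfolding K_def by (intro compact_Times) auto
  define C where "C = {z. is_flow ?V (net_cap A E W p (fst z)) Source Sink (snd z) \<and>
      flow_value ?V Source (snd z) = ?M}"
  have cont: "continuous_on UNIV (\<lambda>z :: real \<times> (('a, 'b) node \<Rightarrow> ('a, 'b) node \<Rightarrow> real). snd z x y)"
    for x y
    by (intro continuous_on_product_then_coordinatewise[where f = "\<lambda>z. snd z x"]
        continuous_on_product_then_coordinatewise[where f = snd] continuous_intros)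
  have cont_cap: "continuous_on UNIV (\<lambda>z :: real \<times> (('a, 'b) node \<Rightarrow> ('a, 'b) node \<Rightarrow> real).
      net_cap A E W p (fst z) x y)" for x y
    by (cases "(A, E, W, p, 0 :: real, x, y)" rule: net_cap.cases) (auto intro!: continuous_intros)
  have C_eq: "C = (\<Inter>x\<in>?V. \<Inter>y\<in>?V. {z. 0 \<le> snd z x y} \<inter> {z. snd z x y \<le> net_cap A E W p (fst z) x y})
      \<inter> (\<Inter>x\<in>?V - {Source, Sink}. {z. (\<Sum>y\<in>?V. snd z y x) = (\<Sum>y\<in>?V. snd z x y)})
      \<inter> {z. (\<Sum>y\<in>?V. snd z Source y) - (\<Sum>y\<in>?V. snd z y Source) = ?M}"
    by (auto simp: C_def is_flow_def flow_value_def)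
  have "closed C" unfolding C_eq
    by (intro closed_Int closed_INT ballI closed_Collect_le closed_Collect_eq cont cont_cap
        continuous_intros)
  with K have KC: "compact (fst ` (K \<inter> C))"
    by (intro compact_continuous_image compact_Int_closed continuous_intros)
  have sub: "T \<in> fst ` (K \<inter> C)" if "T \<in> ?S" "T \<le> T1" for T
  proof -
    from that obtain f where T0: "0 \<le> T" and f: "is_flow ?V (net_cap A E W p T) Source Sink f"
        "flow_value ?V Source f = ?M" by (auto simp: S_iff)
    define g where "g = (\<lambda>x y. if x \<in> ?V \<and> y \<in> ?V then f x y else 0)"
    have "is_flow ?V (net_cap A E W p T) Source Sink g"
      using f(1) by (auto simp: is_flow_def g_def)
    moreover have "flow_value ?V Source g = ?M"
      using f(2) by (simp add: flow_value_def g_def) (simp add: net_nodes_def)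
    moreover have "0 \<le> g x y \<and> g x y \<le> B" for x y
      using f(1) cap_le[of x y T] T0 that(2) B
      by (fastforce simp: g_def is_flow_def)
    ultimately have "(T, g) \<in> K \<inter> C" using T0 that(2) by (auto simp: K_def C_def)
    then show ?thesis by force
  qed
  have sub': "T \<in> ?S" if "T \<in> fst ` (K \<inter> C)" for T
    using that by (auto simp: S_iff K_def C_def)
  obtain T where T: "T \<in> fst ` (K \<inter> C)" and min: "\<And>T'. T' \<in> fst ` (K \<inter> C) \<Longrightarrow> T \<le> T'"
    using compact_attains_inf[OF KC] sub[OF T1] by blast
  have TS: "T \<in> ?S" by (rule sub'[OF T])
  have le: "T \<le> T'" if "T' \<in> ?S" for T'
    using min[of T'] min[OF sub[OF T1]] sub[OF that] by (cases "T' \<le> T1") auto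
  have "Z_flow A U E W p = ennreal T"
    unfolding Z_flow_def using TS le
    by (intro antisym INF_lower INF_greatest ennreal_leI) auto
  with TS le show ?thesis by (rule that)
qed

end

theory Submission
  imports Defs
begin

text \<open>Fix for every arrival sequence an optimal offline assignment, read off the first \<open>OPT\<close> users,
  and send along the edge from \<open>a\<close> to \<open>u\<close> the expected number of users of type \<open>u\<close> that it gives to
  \<open>a\<close>. Every campaign \<open>a\<close> then ships exactly \<open>W a\<close>. Since \<open>OPT\<close> is a stopping time, Wald's identity
  says that the expected number of users of type \<open>u\<close> among the first \<open>OPT\<close> is \<open>pmf p u\<close> times the
  expectation of \<open>OPT\<close>, so this flow respects the capacities of the expected network at time
  \<open>T = E(OPT)\<close>.\<close>

subsection \<open>Saturating flows from transport plans\<close>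

lemma sum_net_nodes:
  fixes h :: "('a, 'u) node \<Rightarrow> 'b::comm_monoid_add"
  assumes "finite A" "finite U"
  shows "sum h (net_nodes A U) =
    h Source + h Sink + (\<Sum>a\<in>A. h (Campaign a)) + (\<Sum>u\<in>U. h (User u))"
proof -
  have "sum h (net_nodes A U) = sum h ({Source, Sink} \<union> Campaign ` A) + sum h (User ` U)"
    unfolding net_nodes_def using assms by (intro sum.union_disjoint) auto
  also have "sum h ({Source, Sink} \<union> Campaign ` A) = sum h {Source, Sink} + sum h (Campaign ` A)"
    using assms by (intro sum.union_disjoint) auto
  finally show ?thesis
    by (simp add: sum.reindex inj_on_def)
qed

text \<open>A flow fixed by its middle layer \<open>g\<close>: source edges are saturated and each
  sink edge forwards what its user receives. Conservation thus holds at users by construction and at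
  campaigns by the demand equation.\<close>

fun transport_flow ::
    "'a set \<Rightarrow> ('a \<Rightarrow> nat) \<Rightarrow> ('a \<Rightarrow> 'u \<Rightarrow> real) \<Rightarrow> ('a, 'u) node \<Rightarrow> ('a, 'u) node \<Rightarrow> real" where
  "transport_flow A W g Source (Campaign a) = real (W a)"
| "transport_flow A W g (Campaign a) (User u) = g a u"
| "transport_flow A W g (User u) Sink = (\<Sum>a\<in>A. g a u)"
| "transport_flow A W g _ _ = 0"

text \<open>All source edges are full, so the value is the total demand, which no flow exceeds.
  Feasibility reduces to the sink edges, where \<open>capacity\<close> is exactly what is
  required.\<close>

lemma saturating_timesI:
  assumes A: "finite A" and U: "finite U" and T: "0 \<le> T"
    and nonneg: "\<And>a u. 0 \<le> g a u"
    and edges: "\<And>a u. (a, u) \<notin> E \<Longrightarrow> g a u = 0"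
    and demand: "\<And>a. a \<in> A \<Longrightarrow> (\<Sum>u\<in>U. g a u) = real (W a)"
    and capacity: "\<And>u. u \<in> U \<Longrightarrow> (\<Sum>a\<in>A. g a u) \<le> T * pmf p u"
  shows "T \<in> saturating_times A U E W p"
proof -
  let ?V = "net_nodes A U" and ?f = "transport_flow A W g"
  \<comment> \<open>The capacity of the middle edges never binds: a campaign ships at most its own
    demand along one edge.\<close>
  have g_le: "g a u \<le> real (total_demand A W)" if "a \<in> A" "u \<in> U" for a u
  proof -
    have "g a u \<le> (\<Sum>u\<in>U. g a u)"
      using that U nonneg by (intro member_le_sum) auto
    also have "\<dots> \<le> real (total_demand A W)"
      using that A member_le_sum[of a A W] by (simp add: demand total_demand_def del: of_nat_sum)
    finally show ?thesis .
  qed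
  have "0 \<le> ?f x y \<and> ?f x y \<le> net_cap A E W p T x y" if "x \<in> ?V" "y \<in> ?V" for x y
    using that g_le nonneg edges capacity
    by (cases "(A, W, g, x, y)" rule: transport_flow.cases)
       (auto simp: net_nodes_def intro!: sum_nonneg)
  moreover have "(\<Sum>y\<in>?V. ?f y x) = (\<Sum>y\<in>?V. ?f x y)" if "x \<in> ?V - {Source, Sink}" for x
  proof -
    from that consider a where "a \<in> A" "x = Campaign a" | u where "u \<in> U" "x = User u"
      by (auto simp: net_nodes_def)
    then show ?thesis by cases (simp_all add: sum_net_nodes[OF A U] demand A)
  qed
  ultimately have flow: "is_flow ?V (net_cap A E W p T) Source Sink ?f"
    by (simp add: is_flow_def)
  have "flow_value ?V Source ?f = real (total_demand A W)"
    by (simp add: flow_value_def sum_net_nodes[OF A U] total_demand_def)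
  with flow T show ?thesis
    using flow_value_le_total_demand[OF A U]
    by (auto simp: saturating_times_def is_max_flow_value_def)
qed

subsection \<open>Optimal offline consumption as a stopping time\<close>

text \<open>Stated on lists so that it visibly depends on the observed types only; this is what
  makes \<open>OPT\<close> a stopping time.\<close>

definition feasible :: "'a set \<Rightarrow> ('a \<times> 'u) set \<Rightarrow> ('a \<Rightarrow> nat) \<Rightarrow> 'u list \<Rightarrow> bool" where
  "feasible A E W xs \<longleftrightarrow> (\<exists>\<sigma>. fulfills A E W ((!) xs) (length xs) \<sigma>)"

lemma fulfills_cong:
  assumes "\<And>i. i < t \<Longrightarrow> x i = y i"
  shows "fulfills A E W x t \<sigma> \<longleftrightarrow> fulfills A E W y t \<sigma>"
  using assms by (auto simp: fulfills_def)

lemma fulfills_prefix: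
  "fulfills A E W ((!) (map x [0..<t])) t \<sigma> \<longleftrightarrow> fulfills A E W x t \<sigma>"
  by (rule fulfills_cong) simp

lemma feasible_prefix: "feasible A E W (map x [0..<t]) \<longleftrightarrow> (\<exists>\<sigma>. fulfills A E W x t \<sigma>)"
  by (simp add: feasible_def fulfills_prefix)

text \<open>The lists on the right stop before position \<open>i\<close>, so whether user
  \<open>i\<close> is among the first \<open>OPT\<close> is settled before her type is seen. Wald's
  identity rests on this.\<close>

lemma less_OPT_iff: "enat i < OPT A E W x \<longleftrightarrow> (\<forall>s\<le>i. \<not> feasible A E W (map x [0..<s]))"
proof
  assume *: "enat i < OPT A E W x"
  show "\<forall>s\<le>i. \<not> feasible A E W (map x [0..<s])"
  proof (intro allI impI notI)
    fix s assume "s \<le> i" "feasible A E W (map x [0..<s])"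
    then have "OPT A E W x \<le> enat s"
      unfolding OPT_def by (intro INF_lower) (simp add: feasible_prefix)
    with * \<open>s \<le> i\<close> show False
      by (meson enat_ord_simps(1) leD order_trans)
  qed
next
  assume *: "\<forall>s\<le>i. \<not> feasible A E W (map x [0..<s])"
  \<comment> \<open>The strict bound is rewritten as a weak one, which passes to the
    infimum.\<close>
  have "eSuc (enat i) \<le> OPT A E W x"
    unfolding OPT_def
  proof (rule INF_greatest)
    fix t assume "t \<in> {t. \<exists>\<sigma>. fulfills A E W x t \<sigma>}"
    then have "\<not> t \<le> i" using * by (auto simp: feasible_prefix)
    then show "eSuc (enat i) \<le> enat t" by (simp add: eSuc_enat)
  qed
  then show "enat i < OPT A E W x"
    by (simp add: ileI1 eSuc_enat Suc_ile_eq)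
qed

lemma feasible_OPT:
  assumes "OPT A E W x = enat t"
  shows "feasible A E W (map x [0..<t])"
proof (rule ccontr)
  assume *: "\<not> feasible A E W (map x [0..<t])"
  have "\<not> feasible A E W (map x [0..<s])" if "s \<le> t" for s
  proof (cases "s = t")
    case False
    \<comment> \<open>Here \<open>s < t\<close> forces \<open>t > 0\<close>, so \<open>t - 1\<close>
      is a true predecessor.\<close>
    with that have s: "s \<le> t - 1" "t - 1 < t" by auto
    then have "enat (t - 1) < OPT A E W x" by (simp add: assms)
    with s show ?thesis by (auto simp: less_OPT_iff)
  qed (use * in simp)
  then have "enat t < OPT A E W x" by (simp add: less_OPT_iff)
  then show False by (simp add: assms)
qed

text \<open>The choice is made per list, not per sample point, so quantities derived from it are
  measurable as soon as the list is.\<close>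

definition plan :: "'a set \<Rightarrow> ('a \<times> 'u) set \<Rightarrow> ('a \<Rightarrow> nat) \<Rightarrow> 'u list \<Rightarrow> nat \<Rightarrow> 'a option" where
  "plan A E W xs = (SOME \<sigma>. fulfills A E W ((!) xs) (length xs) \<sigma>)"

text \<open>The guard makes this \<open>0\<close> on infeasible prefixes, where \<open>plan\<close> is arbitrary.\<close>

definition shown ::
    "'a set \<Rightarrow> ('a \<times> 'u) set \<Rightarrow> ('a \<Rightarrow> nat) \<Rightarrow> 'u list \<Rightarrow> 'a \<Rightarrow> 'u \<Rightarrow> nat" where
  "shown A E W xs a u = (if feasible A E W xs \<and> a \<in> A
     then card {i. i < length xs \<and> xs ! i = u \<and> plan A E W xs i = Some a} else 0)"

lemma fulfills_plan:
  "feasible A E W xs \<Longrightarrow> fulfills A E W ((!) xs) (length xs) (plan A E W xs)"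
  unfolding feasible_def plan_def by (erule someI_ex)

lemma shown_eq_0: "(a, u) \<notin> E \<Longrightarrow> shown A E W xs a u = 0"
  using fulfills_plan[of A E W xs] by (auto simp: shown_def fulfills_def)

text \<open>The users given to \<open>a\<close> are partitioned by their types, all of which lie in
  \<open>U\<close>.\<close>

lemma sum_shown_users:
  assumes "feasible A E W xs" "a \<in> A" "finite U" "set xs \<subseteq> U"
  shows "(\<Sum>u\<in>U. shown A E W xs a u) = W a"
proof -
  let ?I = "\<lambda>u. {i. i < length xs \<and> xs ! i = u \<and> plan A E W xs i = Some a}"
  have "(\<Sum>u\<in>U. card (?I u)) = card (\<Union>u\<in>U. ?I u)"
    using assms(3) by (intro card_UN_disjoint[symmetric]) auto
  also have "(\<Union>u\<in>U. ?I u) = {i. i < length xs \<and> plan A E W xs i = Some a}"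
    using assms(4) by (auto simp: subset_iff)
  also have "card \<dots> = W a"
    using fulfills_plan[OF assms(1)] assms(2) by (simp add: fulfills_def)
  finally show ?thesis using assms by (simp add: shown_def)
qed

text \<open>Supplies the constant bound that makes these counts integrable.\<close>

lemma shown_le_demand: "shown A E W xs a u \<le> W a"
proof (cases "feasible A E W xs \<and> a \<in> A")
  case True
  have "card {i. i < length xs \<and> xs ! i = u \<and> plan A E W xs i = Some a}
      \<le> card {i. i < length xs \<and> plan A E W xs i = Some a}"
    by (intro card_mono) auto
  also have "\<dots> = W a"
    using fulfills_plan[of A E W xs] True by (simp add: fulfills_def)
  finally show ?thesis using True by (simp add: shown_def)
qed (auto simp: shown_def)

text \<open>Each user sees at most one ad, so the sets of users belonging to different campaigns are
  disjoint.\<close>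

lemma sum_shown_campaigns_le:
  assumes "finite A"
  shows "(\<Sum>a\<in>A. shown A E W xs a u) \<le> card {i. i < length xs \<and> xs ! i = u}"
proof -
  let ?I = "\<lambda>a. {i. i < length xs \<and> xs ! i = u \<and> plan A E W xs i = Some a}"
  have "(\<Sum>a\<in>A. shown A E W xs a u) \<le> (\<Sum>a\<in>A. card (?I a))"
    by (intro sum_mono) (simp add: shown_def)
  also have "\<dots> = card (\<Union>a\<in>A. ?I a)"
    using assms by (intro card_UN_disjoint[symmetric]) auto
  also have "\<dots> \<le> card {i. i < length xs \<and> xs ! i = u}"
    by (intro card_mono) auto
  finally show ?thesis .
qed

subsection \<open>Wald's identity for finitely many types\<close>

text \<open>If the two differ, the smaller one is finite and is itself a separating
  \<open>i\<close>.\<close>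

lemma enat_eqI_less: "(\<And>i. enat i < m \<longleftrightarrow> enat i < n) \<Longrightarrow> m = n"
proof (rule ccontr)
  assume *: "\<And>i. enat i < m \<longleftrightarrow> enat i < n" and "m \<noteq> n"
  then consider "m < n" | "n < m" by fastforce
  then show False
  proof cases
    case 1 then obtain k where "m = enat k" by (cases m) auto
    with 1 * show False by blast
  next
    case 2 then obtain k where "n = enat k" by (cases n) auto
    with 2 * show False by blast
  qed
qed

text \<open>Types lie in the finite set \<open>U\<close> at every sample point, not just almost
  surely, so a prefix of given length takes finitely many values.\<close>

locale iid_types = prob_space P for P :: "'w measure" +
  fixes U :: "'u set" and p :: "'u pmf" and X :: "nat \<Rightarrow> 'w \<Rightarrow> 'u"
  assumes finite_types: "finite U"
    and in_types: "X i \<omega> \<in> U"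
    and indep: "indep_vars (\<lambda>_. count_space UNIV) X UNIV"
    and distr_X: "distr P (count_space UNIV) (X i) = measure_pmf p"
begin

definition prefix :: "nat \<Rightarrow> 'w \<Rightarrow> 'u list" where
  "prefix t \<omega> = map (\<lambda>i. X i \<omega>) [0..<t]"

lemma length_prefix [simp]: "length (prefix t \<omega>) = t"
  by (simp add: prefix_def)

lemma set_prefix: "set (prefix t \<omega>) \<subseteq> U"
  using in_types by (auto simp: prefix_def)

lemma take_prefix: "s \<le> t \<Longrightarrow> take s (prefix t \<omega>) = prefix s \<omega>"
  by (simp add: prefix_def take_map)

lemma measurable_X [measurable]: "X i \<in> measurable P (count_space UNIV)"
  using indep by (auto simp: indep_vars_def)

lemma prob_X: "prob {\<omega> \<in> space P. X i \<omega> = u} = pmf p u"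
proof -
  have "pmf p u = measure (distr P (count_space UNIV) (X i)) {u}"
    by (simp add: distr_X measure_pmf_single)
  also have "\<dots> = prob (X i -` {u} \<inter> space P)"
    by (subst measure_distr) auto
  also have "X i -` {u} \<inter> space P = {\<omega> \<in> space P. X i \<omega> = u}" by auto
  finally show ?thesis by simp
qed

lemma prefix_eq_iff: "length xs = t \<Longrightarrow> prefix t \<omega> = xs \<longleftrightarrow> (\<forall>i<t. X i \<omega> = xs ! i)"
  by (auto simp: prefix_def list_eq_iff_nth_eq)

lemma prefix_event [measurable]: "{\<omega> \<in> space P. prefix t \<omega> = xs} \<in> events"
proof (cases "length xs = t")
  case True
  then show ?thesis by (simp add: prefix_eq_iff)
next
  case False
  then have "prefix t \<omega> \<noteq> xs" for \<omega> by auto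
  then show ?thesis by simp
qed

lemma finite_prefixes: "finite {xs. set xs \<subseteq> U \<and> length xs = t}"
  using finite_types by (rule finite_lists_length_eq)

lemma measurable_prefix [measurable]: "prefix t \<in> measurable P (count_space UNIV)"
proof -
  have "prefix t \<in> measurable P (count_space {xs. set xs \<subseteq> U \<and> length xs = t})"
    using set_prefix finite_prefixes
    by (subst measurable_count_space_eq2) (auto simp: vimage_def Int_def conj_commute)
  then show ?thesis
    by (rule measurable_compose) simp
qed

lemma pred_prefix: "Measurable.pred P (\<lambda>\<omega>. R (prefix t \<omega>))"
  by (rule measurable_compose[OF measurable_prefix]) simp

lemma prob_prefix:
  assumes "length xs = t"
  shows "prob {\<omega> \<in> space P. prefix t \<omega> = xs} = (\<Prod>i<t. pmf p (xs ! i))"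
\<comment> \<open>An intersection over no indices would be \<open>UNIV\<close> instead of
  \<open>space P\<close>, so the empty prefix is treated apart.\<close>
proof (cases "t = 0")
  case True
  then show ?thesis using assms by (simp add: prefix_def prob_space)
next
  case False
  have "{\<omega> \<in> space P. prefix t \<omega> = xs} = (\<Inter>i\<in>{..<t}. X i -` {xs ! i} \<inter> space P)"
    using assms False by (auto simp: prefix_eq_iff)
  also have "prob \<dots> = (\<Prod>i<t. prob (X i -` {xs ! i} \<inter> space P))"
    using False by (intro indep_varsD[OF indep]) auto
  also have "\<dots> = (\<Prod>i<t. pmf p (xs ! i))"
    by (intro prod.cong refl) (simp add: vimage_def Int_def conj_commute prob_X)
  finally show ?thesis .
qed

text \<open>Independence of the next type from the past: split the event over the finitely many
  pasts satisfying \<open>R\<close>; in each product formula the last factor is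
  \<open>pmf p u\<close>.\<close>

lemma prob_prefix_next:
  "prob {\<omega> \<in> space P. R (prefix t \<omega>) \<and> X t \<omega> = u} =
    pmf p u * prob {\<omega> \<in> space P. R (prefix t \<omega>)}"
proof -
  let ?S = "{xs. set xs \<subseteq> U \<and> length xs = t} \<inter> {xs. R xs}"
  have fin: "finite ?S" using finite_prefixes by auto
  have "prob {\<omega> \<in> space P. R (prefix t \<omega>) \<and> X t \<omega> = u} =
      prob (\<Union>xs\<in>?S. {\<omega> \<in> space P. prefix (Suc t) \<omega> = xs @ [u]})"
    using set_prefix by (intro arg_cong[where f = prob]) (auto simp: prefix_def)
  also have "\<dots> = (\<Sum>xs\<in>?S. prob {\<omega> \<in> space P. prefix (Suc t) \<omega> = xs @ [u]})"
    using fin by (intro finite_measure_finite_Union) (auto simp: disjoint_family_on_def)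
  also have "\<dots> = (\<Sum>xs\<in>?S. pmf p u * prob {\<omega> \<in> space P. prefix t \<omega> = xs})"
    by (intro sum.cong refl) (auto simp: prob_prefix nth_append intro!: prod.cong)
  also have "\<dots> = pmf p u * (\<Sum>xs\<in>?S. prob {\<omega> \<in> space P. prefix t \<omega> = xs})"
    by (simp add: sum_distrib_left)
  also have "(\<Sum>xs\<in>?S. prob {\<omega> \<in> space P. prefix t \<omega> = xs}) =
      prob (\<Union>xs\<in>?S. {\<omega> \<in> space P. prefix t \<omega> = xs})"
    using fin by (intro finite_measure_finite_Union[symmetric]) (auto simp: disjoint_family_on_def)
  also have "(\<Union>xs\<in>?S. {\<omega> \<in> space P. prefix t \<omega> = xs}) = {\<omega> \<in> space P. R (prefix t \<omega>)}"
    using set_prefix by auto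
  finally show ?thesis .
qed

text \<open>Each event \<open>enat i < \<tau> \<omega>\<close> is decided by the first
  \<open>i\<close> types, and these countably many events determine
  \<open>\<tau> \<omega>\<close>.\<close>

lemma measurable_stopping:
  fixes \<tau> :: "'w \<Rightarrow> enat"
  assumes "\<And>i \<omega>. enat i < \<tau> \<omega> \<longleftrightarrow> R i (prefix i \<omega>)"
  shows "\<tau> \<in> measurable P (count_space UNIV)"
proof -
  have [measurable]: "Measurable.pred P (\<lambda>\<omega>. R i (prefix i \<omega>))" for i
    by (rule pred_prefix)
  have "\<tau> -` {n} \<inter> space P \<in> events" for n
  proof -
    have "\<tau> \<omega> = n \<longleftrightarrow> (\<forall>i. enat i < \<tau> \<omega> \<longleftrightarrow> enat i < n)" for \<omega>
      using enat_eqI_less by blast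
    then have "\<tau> -` {n} \<inter> space P = {\<omega> \<in> space P. \<forall>i. R i (prefix i \<omega>) \<longleftrightarrow> enat i < n}"
      unfolding assms by blast
    also have "\<dots> \<in> events" by measurable
    finally show ?thesis .
  qed
  then show ?thesis
    by (subst measurable_count_space_eq2_countable) auto
qed

text \<open>Reaching position \<open>i\<close> depends only on earlier types, so it is independent
  of \<open>X i \<omega> = u\<close> and each summand contributes a factor \<open>pmf p u\<close>.
  Working in \<open>ennreal\<close> lets sum and integral be exchanged and allows an infinite
  expectation.\<close>

theorem Wald:
  fixes \<tau> :: "'w \<Rightarrow> enat"
  assumes stop: "\<And>i \<omega>. enat i < \<tau> \<omega> \<longleftrightarrow> R i (prefix i \<omega>)"
  shows "(\<integral>\<^sup>+\<omega>. (\<Sum>i. of_bool (enat i < \<tau> \<omega> \<and> X i \<omega> = u)) \<partial>P) =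
    ennreal (pmf p u) * (\<integral>\<^sup>+\<omega>. ennreal_of_enat (\<tau> \<omega>) \<partial>P)"
proof -
  have [measurable]: "Measurable.pred P (\<lambda>\<omega>. R i (prefix i \<omega>))" for i
    by (rule pred_prefix)
  have ev: "{\<omega> \<in> space P. enat i < \<tau> \<omega> \<and> X i \<omega> = u} \<in> events" for i
    unfolding stop by measurable
  have "(\<integral>\<^sup>+\<omega>. (\<Sum>i. of_bool (enat i < \<tau> \<omega> \<and> X i \<omega> = u)) \<partial>P) =
      (\<Sum>i. \<integral>\<^sup>+\<omega>. of_bool (enat i < \<tau> \<omega> \<and> X i \<omega> = u) \<partial>P)"
    unfolding stop by (intro nn_integral_suminf) measurable
  also have "\<dots> = (\<Sum>i. emeasure P {\<omega> \<in> space P. enat i < \<tau> \<omega> \<and> X i \<omega> = u})"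
  proof (intro suminf_cong)
    fix i
    have "(\<integral>\<^sup>+\<omega>. of_bool (enat i < \<tau> \<omega> \<and> X i \<omega> = u) \<partial>P) =
        (\<integral>\<^sup>+\<omega>. indicator {\<omega> \<in> space P. enat i < \<tau> \<omega> \<and> X i \<omega> = u} \<omega> \<partial>P)"
      by (intro nn_integral_cong) (auto simp: indicator_def)
    then show "(\<integral>\<^sup>+\<omega>. of_bool (enat i < \<tau> \<omega> \<and> X i \<omega> = u) \<partial>P) =
        emeasure P {\<omega> \<in> space P. enat i < \<tau> \<omega> \<and> X i \<omega> = u}"
      using ev by simp
  qed
  also have "\<dots> = (\<Sum>i. ennreal (pmf p u) * emeasure P {\<omega> \<in> space P. enat i < \<tau> \<omega>})"
    by (simp add: stop emeasure_eq_measure prob_prefix_next ennreal_mult)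
  also have "\<dots> = ennreal (pmf p u) * (\<Sum>i. emeasure P {\<omega> \<in> space P. enat i < \<tau> \<omega>})"
    by (rule ennreal_suminf_cmult)
  \<comment> \<open>Tail-sum formula for the expectation of an extended natural number.\<close>
  also have "(\<Sum>i. emeasure P {\<omega> \<in> space P. enat i < \<tau> \<omega>}) =
      (\<integral>\<^sup>+\<omega>. ennreal_of_enat (\<tau> \<omega>) \<partial>P)"
    by (rule nn_integral_enat_function[symmetric, OF measurable_stopping[where R = R, OF stop]])
  finally show ?thesis .
qed

section \<open>The expected offline assignment as a saturating flow\<close>

lemma Z_flow_le_expected_OPT:
  assumes A: "finite A"
  shows "Z_flow A U E W p \<le> (\<integral>\<^sup>+\<omega>. ennreal_of_enat (OPT A E W (\<lambda>i. X i \<omega>)) \<partial>P)"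
    (is "_ \<le> ?EO")
proof (cases "?EO = \<infinity>")
  case False
  define \<tau> where "\<tau> \<omega> = OPT A E W (\<lambda>i. X i \<omega>)" for \<omega>
  \<comment> \<open>A predicate of one list of length \<open>i\<close>; \<open>take\<close> recovers
    the shorter prefixes mentioned in \<open>less_OPT_iff\<close>.\<close>
  define R where "R i xs \<longleftrightarrow> (\<forall>s\<le>i. \<not> feasible A E W (take s xs))" for i xs
  have stop: "enat i < \<tau> \<omega> \<longleftrightarrow> R i (prefix i \<omega>)" for i \<omega>
    by (simp add: R_def \<tau>_def less_OPT_iff take_prefix prefix_def[symmetric])
  note [measurable] = measurable_stopping[where R = R, OF stop]
  define T where "T = enn2real (\<integral>\<^sup>+\<omega>. ennreal_of_enat (\<tau> \<omega>) \<partial>P)"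
  have T: "(\<integral>\<^sup>+\<omega>. ennreal_of_enat (\<tau> \<omega>) \<partial>P) = ennreal T" "0 \<le> T"
    using False by (auto simp: T_def \<tau>_def top.not_eq_extremum)
  have fin: "AE \<omega> in P. \<tau> \<omega> \<noteq> \<infinity>"
  proof -
    have "AE \<omega> in P. ennreal_of_enat (\<tau> \<omega>) \<noteq> \<infinity>"
      by (rule nn_integral_PInf_AE) (auto simp: T)
    then show ?thesis by eventually_elim (metis ennreal_of_enat_infty infinity_ennreal_def)
  qed
  \<comment> \<open>Where \<open>\<tau>\<close> is infinite, \<open>the_enat\<close> is unspecified;
    by \<open>fin\<close> this concerns a null set only.\<close>
  define seen where "seen \<omega> = prefix (the_enat (\<tau> \<omega>)) \<omega>" for \<omega>
  have seen_meas: "seen \<in> measurable P (count_space UNIV)"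
    unfolding seen_def
    \<comment> \<open>A prefix of random length is measurable because its length has countably many
      values.\<close>
    by (rule measurable_compose_countable[where f = prefix]) measurable
  have feas: "feasible A E W (seen \<omega>)" if "\<tau> \<omega> \<noteq> \<infinity>" for \<omega>
    using that feasible_OPT[of A E W "\<lambda>i. X i \<omega>"] by (auto simp: \<tau>_def seen_def prefix_def)
  define N where "N a u \<omega> = real (shown A E W (seen \<omega>) a u)" for a u \<omega>
  have N_meas [measurable]: "N a u \<in> borel_measurable P" for a u
    unfolding N_def by (rule measurable_compose[OF seen_meas]) simp
  have N_int: "integrable P (N a u)" for a u
    by (rule integrable_const_bound[where B = "real (W a)"]) (auto simp: N_def shown_le_demand)
  define g where "g a u = (\<integral>\<omega>. N a u \<omega> \<partial>P)" for a u
  have "T \<in> saturating_times A U E W p"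
  proof (rule saturating_timesI[where g = g])
    show "0 \<le> g a u" for a u by (simp add: g_def N_def)
    show "g a u = 0" if "(a, u) \<notin> E" for a u
      using that by (simp add: g_def N_def shown_eq_0)
    show "(\<Sum>u\<in>U. g a u) = real (W a)" if "a \<in> A" for a
    proof -
      have "(\<Sum>u\<in>U. g a u) = (\<integral>\<omega>. (\<Sum>u\<in>U. N a u \<omega>) \<partial>P)"
        by (simp add: g_def N_int)
      also have "\<dots> = (\<integral>\<omega>. real (W a) \<partial>P)"
      proof (intro integral_cong_AE)
        show "AE \<omega> in P. (\<Sum>u\<in>U. N a u \<omega>) = real (W a)"
          using fin
        proof eventually_elim
          case (elim \<omega>)
          have "(\<Sum>u\<in>U. shown A E W (seen \<omega>) a u) = W a"
            using feas[OF elim] that finite_types set_prefix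
            by (intro sum_shown_users) (auto simp: seen_def)
          then show ?case by (simp add: N_def flip: of_nat_sum)
        qed
      qed auto
      finally show ?thesis by (simp add: prob_space)
    qed
    show "(\<Sum>a\<in>A. g a u) \<le> T * pmf p u" for u
    proof -
      \<comment> \<open>The comparison moves to \<open>ennreal\<close>, where Wald's identity is
        stated.\<close>
      have "ennreal (\<Sum>a\<in>A. g a u) = ennreal (\<integral>\<omega>. (\<Sum>a\<in>A. N a u \<omega>) \<partial>P)"
        by (simp add: g_def N_int)
      also have "\<dots> = (\<integral>\<^sup>+\<omega>. ennreal (\<Sum>a\<in>A. N a u \<omega>) \<partial>P)"
        by (intro nn_integral_eq_integral[symmetric] Bochner_Integration.integrable_sum N_int)
           (auto simp: N_def intro!: sum_nonneg)
      also have "\<dots> \<le> (\<integral>\<^sup>+\<omega>. (\<Sum>i. of_bool (enat i < \<tau> \<omega> \<and> X i \<omega> = u)) \<partial>P)"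
      proof (rule nn_integral_mono_AE)
        show "AE \<omega> in P. ennreal (\<Sum>a\<in>A. N a u \<omega>) \<le>
            (\<Sum>i. of_bool (enat i < \<tau> \<omega> \<and> X i \<omega> = u))"
          using fin
        proof eventually_elim
          case (elim \<omega>)
          then obtain t where t: "\<tau> \<omega> = enat t" by auto
          have "(\<Sum>a\<in>A. shown A E W (seen \<omega>) a u) \<le> card {i. i < t \<and> X i \<omega> = u}"
            using sum_shown_campaigns_le[OF A, of E W "seen \<omega>" u]
            by (auto simp: seen_def t prefix_def cong: conj_cong)
          then have "ennreal (\<Sum>a\<in>A. N a u \<omega>) \<le> of_nat (card {i. i < t \<and> X i \<omega> = u})"
            by (simp add: N_def ennreal_of_nat_eq_real_of_nat flip: of_nat_sum)
          \<comment> \<open>The count becomes a partial sum of the series in Wald's identity, whose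
            terms are nonnegative.\<close>
          also have "\<dots> = (\<Sum>i<t. of_bool (enat i < \<tau> \<omega> \<and> X i \<omega> = u))"
            by (simp add: t of_bool_def sum.If_cases lessThan_def Int_def cong: conj_cong)
          also have "\<dots> \<le> (\<Sum>i. of_bool (enat i < \<tau> \<omega> \<and> X i \<omega> = u))"
            by (intro sum_le_suminf) auto
          finally show ?case .
        qed
      qed
      also have "\<dots> = ennreal (T * pmf p u)"
        using T(2) by (simp add: Wald[where R = R, OF stop] T(1) ennreal_mult mult.commute)
      finally show ?thesis using T(2) by (simp add: ennreal_le_iff)
    qed
  qed (use A finite_types T in auto)
  then have "Z_flow A U E W p \<le> ennreal T"
    unfolding Z_flow_def by (rule INF_lower)
  with T show ?thesis by (simp add: \<tau>_def)
qed simp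

end

section \<open>Reduction to types that lie in \<open>U\<close> everywhere\<close>

theorem theorem1:
  fixes A :: "'a set" and U :: "'u set" and E :: "('a \<times> 'u) set"
    and W :: "'a \<Rightarrow> nat" and p :: "'u pmf"
    and P :: "'w measure" and X :: "nat \<Rightarrow> 'w \<Rightarrow> 'u"
  assumes "finite A" and "finite U" and "E \<subseteq> A \<times> U"
    and "\<And>a. a \<in> A \<Longrightarrow> 0 < W a"
    and "set_pmf p \<subseteq> U"
    and "prob_space P"
    and "prob_space.indep_vars P (\<lambda>_. count_space UNIV) X UNIV"
    and "\<And>i. distr P (count_space UNIV) (X i) = measure_pmf p"
  shows "Z_flow A U E W p \<le> (\<integral>\<^sup>+ \<omega>. ennreal_of_enat (OPT A E W (\<lambda>i. X i \<omega>)) \<partial>P)"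
proof -
  interpret prob_space P by fact
  obtain u0 where u0: "u0 \<in> U"
    using set_pmf_not_empty[of p] assms(5) by blast
  \<comment> \<open>The types need not lie in \<open>U\<close> on a null set, and \<open>'u\<close> may be uncountable, so a
    prefix of \<open>X\<close> need not be measurable as a list; retracting onto \<open>U\<close> repairs this.\<close>
  define r where "r u = (if u \<in> U then u else u0)" for u
  have X_meas [measurable]: "X i \<in> measurable P (count_space UNIV)" for i
    using assms(7) by (auto simp: indep_vars_def)
  \<comment> \<open>The retraction fixes the support of \<open>p\<close>, so the retracted types
    have the same law.\<close>
  have "map_pmf r p = map_pmf id p"
    using assms(5) by (intro map_pmf_cong) (auto simp: r_def)
  then have r_p: "distr (measure_pmf p) (count_space UNIV) r = measure_pmf p"
    by (simp flip: map_pmf_rep_eq)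
  interpret Y: iid_types P U p "\<lambda>i \<omega>. r (X i \<omega>)"
  proof
    show "indep_vars (\<lambda>_. count_space UNIV) (\<lambda>i \<omega>. r (X i \<omega>)) UNIV"
      by (rule indep_vars_compose2[OF assms(7)]) simp
    show "distr P (count_space UNIV) (\<lambda>\<omega>. r (X i \<omega>)) = measure_pmf p" for i
      using distr_distr[of r "count_space UNIV" "count_space UNIV" "X i" P]
      by (simp add: assms(8) r_p comp_def)
  qed (use assms(2) u0 in \<open>auto simp: r_def\<close>)
  have "AE \<omega> in P. X i \<omega> \<in> U" for i
  proof -
    have "AE u in distr P (count_space UNIV) (X i). u \<in> U"
      unfolding assms(8) using assms(5) by (auto simp: AE_measure_pmf_iff)
    then show ?thesis by (subst (asm) AE_distr_iff) auto
  qed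
  \<comment> \<open>Countably many null sets unite to a null set, so almost surely the whole
    sequence is unchanged by \<open>r\<close>, and with it \<open>OPT\<close>.\<close>
  then have "AE \<omega> in P. \<forall>i. X i \<omega> \<in> U"
    by (simp add: AE_all_countable)
  then have "AE \<omega> in P. (\<lambda>i. r (X i \<omega>)) = (\<lambda>i. X i \<omega>)"
    by eventually_elim (simp add: r_def)
  then have "(\<integral>\<^sup>+ \<omega>. ennreal_of_enat (OPT A E W (\<lambda>i. r (X i \<omega>))) \<partial>P) =
      (\<integral>\<^sup>+ \<omega>. ennreal_of_enat (OPT A E W (\<lambda>i. X i \<omega>)) \<partial>P)"
    by (intro nn_integral_cong_AE) (erule eventually_mono, simp)
  then show ?thesis
    using Y.Z_flow_le_expected_OPT[OF assms(1), of E W] by simp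
qed

end
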